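(* Let $E\subset\mathbb{T}$ be a closed set, let $\rho>0$ and $K>0$, and let $\phi(x)=\exp\{-x^{-\rho}\}$ for $x>0$, $\phi(0)=0$. Let $B$ be a Blaschke product whose zero set satisfies $Z(B)\subset\mathcal{S}_\phi(E,K)$. Then $B'\in\mathcal{A}(E,\rho)$.
   Context: $\mathbb{D}$ is the open unit disk in $\mathbb{C}$, $\mathbb{T}$ the unit circle, and $d(z,E)=\mathrm{dist}(z,E)$ is the Euclidean distance from $z$ to $E$. Blaschke product: for a sequence $\{z_n\}_{n\ge1}\subset\mathbb{D}$ (repetitions allowed) with $\sum_{n=1}^\infty(1-|z_n|)<\infty$, $$B(z)=\prod_{n=1}^\infty b_n(z),\qquad b_n(z)=\frac{\overline{z_n}}{|z_n|}\,\frac{z_n-z}{1-\overline{z_n}z},$$ and $Z(B)=\{z_n\}$ is its zero set. Standing assumption: $B(0)\neq0$, i.e. all $z_n\ne0$. Stolz region associated with $\phi$ and a closed set $E\subset\mathbb{T}$: for $K>0$, $\mathcal{S}_\phi(E,K)=\{\lambda\in\mathbb{D}:\ \phi(d(\lambda,E))\le K(1-|\lambda|)\}$. The space $\mathcal{A}(E,\rho)$: an analytic function $f$ on $\mathbb{D}$ belongs to $\mathcal{A}(E,\rho)$ if there are positive constants $C_1,C_2$ such that $$|f(z)|\le C_1\exp\left(\frac{C_2}{d^\rho(z,E)}\right)\quad\text{for all }z\in\mathbb{D},$$ where $d^\rho(z,E)=(d(z,E))^\rho$. *)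

theory Defs
  imports "HOL-Complex_Analysis.Complex_Analysis"
begin

definition blaschke_factor :: "complex \<Rightarrow> complex \<Rightarrow> complex" where
  "blaschke_factor a w = cnj a / of_real (cmod a) * ((a - w) / (1 - cnj a * w))"

text \<open>Zero sequences are indexed from 0; repetitions are allowed. The condition
  \<^prop>\<open>a n \<noteq> 0\<close> is the normalization that the product does not vanish at the origin.\<close>

definition blaschke_sequence :: "(nat \<Rightarrow> complex) \<Rightarrow> bool" where
  "blaschke_sequence a \<longleftrightarrow>
     (\<forall>n. a n \<in> ball 0 1 \<and> a n \<noteq> 0) \<and> summable (\<lambda>n. 1 - cmod (a n))"

definition blaschke_product :: "(nat \<Rightarrow> complex) \<Rightarrow> complex \<Rightarrow> complex" where
  "blaschke_product a w = (\<Prod>n. blaschke_factor (a n) w)"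

text \<open>In the next two definitions \<^term>\<open>infdist z E\<close> is the Euclidean distance from \<open>z\<close> to \<open>E\<close>
  only for nonempty \<open>E\<close>; the library sets it to 0 when \<open>E\<close> is empty.\<close>

definition stolz_region :: "(real \<Rightarrow> real) \<Rightarrow> complex set \<Rightarrow> real \<Rightarrow> complex set" where
  "stolz_region \<phi> E K = {w \<in> ball 0 1. \<phi> (infdist w E) \<le> K * (1 - cmod w)}"

definition growth_space :: "complex set \<Rightarrow> real \<Rightarrow> (complex \<Rightarrow> complex) set" where
  "growth_space E \<rho> = {f. f holomorphic_on ball 0 1 \<and>
     (\<exists>C1>0. \<exists>C2>0. \<forall>z\<in>ball 0 1. cmod (f z) \<le> C1 * exp (C2 / infdist z E powr \<rho>))}"

text \<open>The value at negative arguments is irrelevant.\<close>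

definition exp_weight :: "real \<Rightarrow> real \<Rightarrow> real" where
  "exp_weight \<rho> x = (if x > 0 then exp (- (x powr (- \<rho>))) else 0)"

end

theory Submission
  imports Defs
begin

text \<open>
  Write \<open>b\<^sub>a\<close> for the factor with zero \<open>a\<close>. In the product rule for \<open>B\<close> every undifferentiated
  factor has modulus at most 1, so \<open>\<bar>B'(z)\<bar>\<close> is at most the sum of the \<open>\<bar>b\<^sub>a'(z)\<bar>\<close> over the zeros,
  where \<open>\<bar>b\<^sub>a'(z)\<bar> = (1 - \<bar>a\<bar>\<^sup>2) / \<bar>1 - cnj a * z\<bar>\<^sup>2\<close>. By the Blaschke condition this sum is at most a
  constant times
  \<open>sup\<^sub>n 1 / \<bar>1 - cnj (a\<^sub>n) * z\<bar>\<^sup>2\<close>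
  (\<open>norm_deriv_blaschke_product_le\<close>).

  That supremum is controlled by \<open>d = dist(z, E)\<close> alone, uniformly over the Stolz region
  (\<open>inverse_square_one_minus_cnj_mult_le\<close>). A zero \<open>a\<close> with \<open>dist(a, E) \<ge> d/2\<close> is kept away
  from the circle by the Stolz condition: \<open>1 - \<bar>a\<bar>\<close>, and with it the denominator
  \<open>\<bar>1 - cnj a * z\<bar>\<close>, is at least \<open>exp (- ((d/2) powr -\<rho>)) / K\<close>. A zero with \<open>dist(a, E) < d/2\<close> is at
  distance at least \<open>d/2\<close> from \<open>z\<close>, and the denominator is at least \<open>\<bar>a - z\<bar>\<close>. The resulting
  bound \<open>4 / d\<^sup>2\<close> is again at most exponential in \<open>d powr -\<rho>\<close>.
\<close>

section \<open>A single Blaschke factor\<close>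

lemma one_minus_cnj_mult_ge:
  fixes a w :: complex
  assumes "cmod a \<le> 1" "cmod w \<le> 1"
  shows "1 - cmod a \<le> cmod (1 - cnj a * w)" and "1 - cmod w \<le> cmod (1 - cnj a * w)"
proof -
  have "1 - cmod a * cmod w \<le> cmod (1 - cnj a * w)"
    using norm_triangle_ineq2[of 1 "cnj a * w"] by (simp add: norm_mult)
  moreover have "cmod a * cmod w \<le> cmod a" "cmod a * cmod w \<le> cmod w"
    using assms by (auto simp: mult_left_le mult_left_le_one_le)
  ultimately show "1 - cmod a \<le> cmod (1 - cnj a * w)" "1 - cmod w \<le> cmod (1 - cnj a * w)"
    by linarith+
qed

lemma one_minus_cnj_mult_nonzero:
  fixes a w :: complex
  assumes "cmod a < 1" "cmod w < 1"
  shows "1 - cnj a * w \<noteq> 0"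
  using one_minus_cnj_mult_ge(1)[of a w] assms by auto

text \<open>Equivalently, the pseudohyperbolic distance is at most 1. This single inequality gives both
  the bound by 1 on a Blaschke factor and a lower bound on its denominator for zeros far from the
  argument.\<close>

lemma norm_diff_le_one_minus_cnj_mult:
  fixes a w :: complex
  assumes "cmod a \<le> 1" "cmod w \<le> 1"
  shows "cmod (a - w) \<le> cmod (1 - cnj a * w)"
proof -
  have "(cmod (1 - cnj a * w))\<^sup>2 = (cmod (a - w))\<^sup>2 + (1 - (cmod a)\<^sup>2) * (1 - (cmod w)\<^sup>2)"
    unfolding cmod_power2 by (simp add: power2_eq_square algebra_simps)
  moreover have "(1 - (cmod a)\<^sup>2) * (1 - (cmod w)\<^sup>2) \<ge> 0"
    using assms by (intro mult_nonneg_nonneg) (simp_all add: power_le_one)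
  ultimately have "(cmod (a - w))\<^sup>2 \<le> (cmod (1 - cnj a * w))\<^sup>2"
    by linarith
  then show ?thesis
    by (rule power2_le_imp_le) simp
qed

lemma norm_blaschke_factor_le_1:
  assumes "cmod a < 1" "cmod w < 1"
  shows "cmod (blaschke_factor a w) \<le> 1"
proof -
  have "cmod (a - w) / cmod (1 - cnj a * w) \<le> 1"
    using norm_diff_le_one_minus_cnj_mult[of a w] assms by (auto simp: divide_le_eq_1)
  then show ?thesis
    by (cases "a = 0") (simp_all add: blaschke_factor_def norm_mult norm_divide)
qed

text \<open>Clearing denominators, the numerator of \<open>b\<^sub>a - 1\<close> factors as
  \<open>(\<bar>a\<bar> - 1) * (\<bar>a\<bar> + cnj a * w)\<close>; the remaining \<open>\<bar>a\<bar>\<close> in the denominator cancels, which leaves a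
  bound summable over the zeros and uniform on compact sets.\<close>

lemma norm_blaschke_factor_minus_1_le:
  assumes "cmod a < 1" "a \<noteq> 0" "cmod w < 1"
  shows "cmod (blaschke_factor a w - 1) \<le> 2 / (1 - cmod w) * (1 - cmod a)"
proof -
  define c where "c = complex_of_real (cmod a)"
  have nz: "1 - cnj a * w \<noteq> 0" and c0: "c \<noteq> 0"
    using one_minus_cnj_mult_nonzero assms by (auto simp: c_def)
  have cc: "cnj a * a = c * c"
    using complex_norm_square[of a] by (simp add: c_def power2_eq_square mult.commute)
  have "blaschke_factor a w - 1 = (cnj a * (a - w) - c * (1 - cnj a * w)) / (c * (1 - cnj a * w))"
    unfolding blaschke_factor_def c_def[symmetric] using nz c0 by (simp add: divide_simps)
  also have "cnj a * (a - w) - c * (1 - cnj a * w) = (c - 1) * (c + cnj a * w)"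
    using cc by (simp add: algebra_simps)
  finally have eq: "blaschke_factor a w - 1 = (c - 1) * (c + cnj a * w) / (c * (1 - cnj a * w))" .
  have "c - 1 = of_real (cmod a - 1)"
    by (simp add: c_def)
  then have "cmod (c - 1) = 1 - cmod a"
    using assms(1) by (simp only: norm_of_real)
  moreover have "cmod c = cmod a"
    by (simp add: c_def)
  ultimately have "cmod (blaschke_factor a w - 1)
      = (1 - cmod a) * cmod (c + cnj a * w) / (cmod a * cmod (1 - cnj a * w))"
    unfolding eq by (simp only: norm_mult norm_divide)
  also have "\<dots> \<le> (1 - cmod a) * (cmod a * 2) / (cmod a * (1 - cmod w))"
  proof -
    have "cmod (c + cnj a * w) \<le> cmod a + cmod a * cmod w"
      using norm_triangle_ineq[of c "cnj a * w"] by (simp add: c_def norm_mult)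
    also have "\<dots> \<le> cmod a * 2"
      using assms mult_left_le[of "cmod w" "cmod a"] by simp
    finally show ?thesis
      using assms one_minus_cnj_mult_ge(2)[of a w]
      by (intro frac_le mult_mono mult_left_mono) auto
  qed
  also have "\<dots> = 2 / (1 - cmod w) * (1 - cmod a)"
    using assms by (simp add: field_simps)
  finally show ?thesis .
qed

lemma has_field_derivative_blaschke_factor:
  assumes "cmod a < 1" "cmod w < 1"
  shows "(blaschke_factor a has_field_derivative
           cnj a / of_real (cmod a) * ((cnj a * a - 1) / (1 - cnj a * w)\<^sup>2)) (at w)"
  unfolding blaschke_factor_def[abs_def]
proof (rule DERIV_cmult)
  show "((\<lambda>w. (a - w) / (1 - cnj a * w)) has_field_derivative
          (cnj a * a - 1) / (1 - cnj a * w)\<^sup>2) (at w)"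
    using one_minus_cnj_mult_nonzero[OF assms]
    by (auto intro!: derivative_eq_intros simp: power2_eq_square) (simp add: algebra_simps)
qed

lemma field_differentiable_blaschke_factor:
  assumes "cmod a < 1" "cmod w < 1"
  shows "blaschke_factor a field_differentiable at w"
  unfolding field_differentiable_def
  by (rule exI, rule has_field_derivative_blaschke_factor[OF assms])

lemma holomorphic_blaschke_factor:
  assumes "cmod a < 1"
  shows "blaschke_factor a holomorphic_on ball 0 1"
  unfolding holomorphic_on_def
  using field_differentiable_at_within[OF field_differentiable_blaschke_factor[OF assms]]
  by simp

lemma norm_deriv_blaschke_factor_le:
  assumes "cmod a < 1" "cmod w < 1"
  shows "cmod (deriv (blaschke_factor a) w) \<le> 2 * (1 - cmod a) / (cmod (1 - cnj a * w))\<^sup>2"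
proof -
  have "cnj a * a - 1 = of_real ((cmod a)\<^sup>2 - 1)"
    using complex_norm_square[of a] by (simp add: mult.commute)
  then have "cmod (cnj a * a - 1) = \<bar>(cmod a)\<^sup>2 - 1\<bar>"
    by (simp only: norm_of_real)
  also have "\<dots> = (1 - cmod a) * (1 + cmod a)"
    using assms(1) abs_square_le_1[of "cmod a"] by (simp add: power2_eq_square algebra_simps)
  also have "\<dots> \<le> (1 - cmod a) * 2"
    using assms by (intro mult_left_mono) auto
  finally have num: "cmod (cnj a * a - 1) \<le> 2 * (1 - cmod a)"
    by simp
  have "cmod (deriv (blaschke_factor a) w)
      = cmod (cnj a / of_real (cmod a)) * (cmod (cnj a * a - 1) / (cmod (1 - cnj a * w))\<^sup>2)"
    using DERIV_imp_deriv[OF has_field_derivative_blaschke_factor[OF assms]]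
    by (simp only: norm_mult norm_divide norm_power)
  also have "\<dots> \<le> 1 * (cmod (cnj a * a - 1) / (cmod (1 - cnj a * w))\<^sup>2)"
    by (intro mult_right_mono) (auto simp: norm_divide)
  also have "\<dots> \<le> 2 * (1 - cmod a) / (cmod (1 - cnj a * w))\<^sup>2"
    using num by (simp add: divide_right_mono)
  finally show ?thesis .
qed

section \<open>The derivative of a Blaschke product\<close>

text \<open>The product rule is used without dividing by the product, so that zeros of the factors
  at \<open>z\<close> do no harm.\<close>

lemma norm_deriv_prod_le_sum:
  fixes f :: "'i \<Rightarrow> complex \<Rightarrow> complex"
  assumes diff: "\<And>i. i \<in> A \<Longrightarrow> f i field_differentiable at z"
    and le1: "\<And>i. i \<in> A \<Longrightarrow> cmod (f i z) \<le> 1"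
  shows "cmod (deriv (\<lambda>w. \<Prod>i\<in>A. f i w) z) \<le> (\<Sum>i\<in>A. cmod (deriv (f i) z))"
proof -
  have "deriv (\<lambda>w. \<Prod>i\<in>A. f i w) z = (\<Sum>i\<in>A. deriv (f i) z * (\<Prod>j\<in>A-{i}. f j z))"
    using diff by (intro DERIV_imp_deriv has_field_derivative_prod)
                  (simp add: field_differentiable_derivI)
  also have "cmod \<dots> \<le> (\<Sum>i\<in>A. cmod (deriv (f i) z) * cmod (\<Prod>j\<in>A-{i}. f j z))"
    by (intro sum_norm_le) (simp add: norm_mult)
  also have "\<dots> \<le> (\<Sum>i\<in>A. cmod (deriv (f i) z))"
    using le1 by (intro sum_mono mult_left_le) (auto simp: prod_norm[symmetric] intro!: prod_le_1)
  finally show ?thesis .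
qed

text \<open>The M-test applied to the \<open>b\<^sub>a - 1\<close> makes the partial products
  converge uniformly, and their limit is the infinite product because absolute convergence
  holds at each point.\<close>

lemma uniform_limit_blaschke_product:
  assumes a: "blaschke_sequence a" and r: "r < 1"
  shows "uniform_limit (cball 0 r) (\<lambda>N w. \<Prod>n<N. blaschke_factor (a n) w)
           (blaschke_product a) sequentially"
proof -
  have a1: "cmod (a n) < 1" and a0: "a n \<noteq> 0" for n
    using a by (auto simp: blaschke_sequence_def)
  have sa: "summable (\<lambda>n. C * (1 - cmod (a n)))" for C
    using a by (auto simp: blaschke_sequence_def intro: summable_mult)
  have bound: "norm (norm (blaschke_factor (a n) w - 1)) \<le> 2 / (1 - r) * (1 - cmod (a n))"
    if "w \<in> cball 0 r" for n w
  proof -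
    have "cmod (blaschke_factor (a n) w - 1) \<le> 2 / (1 - cmod w) * (1 - cmod (a n))"
      using that r a1 a0 by (intro norm_blaschke_factor_minus_1_le) auto
    also have "\<dots> \<le> 2 / (1 - r) * (1 - cmod (a n))"
      using that r a1[of n] by (intro mult_right_mono divide_left_mono) auto
    finally show ?thesis by simp
  qed
  have "uniformly_convergent_on (cball 0 r) (\<lambda>N w. \<Prod>n<N. blaschke_factor (a n) w)"
  proof (rule uniformly_convergent_on_prod')
    show "continuous_on (cball 0 r) (blaschke_factor (a n))" for n
      using r by (intro holomorphic_on_imp_continuous_on
          holomorphic_on_subset[OF holomorphic_blaschke_factor[OF a1]]) auto
    show "uniformly_convergent_on (cball 0 r) (\<lambda>N w. \<Sum>n<N. norm (blaschke_factor (a n) w - 1))"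
      by (rule Weierstrass_m_test'[OF bound sa])
  qed auto
  then obtain P where P: "uniform_limit (cball 0 r)
      (\<lambda>N w. \<Prod>n<N. blaschke_factor (a n) w) P sequentially"
    by (auto simp: uniformly_convergent_on_def)
  have "blaschke_product a w = P w" if w: "w \<in> cball 0 r" for w
  proof -
    have "summable (\<lambda>n. norm (blaschke_factor (a n) w - 1))"
      by (rule summable_comparison_test'[OF sa bound[OF w]])
    then have "convergent_prod (\<lambda>n. blaschke_factor (a n) w)"
      by (intro abs_convergent_prod_imp_convergent_prod summable_imp_abs_convergent_prod)
    then have "(\<lambda>N. \<Prod>n<N. blaschke_factor (a n) w) \<longlonglongrightarrow> blaschke_product a w"
      unfolding blaschke_product_def
      by (intro has_prod_imp_tendsto' convergent_prod_has_prod)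
    with tendsto_uniform_limitI[OF P w] show ?thesis
      using LIMSEQ_unique by blast
  qed
  then show ?thesis
    by (intro iffD2[OF uniform_limit_cong' P]) auto
qed

lemma partial_blaschke_product_holomorphic:
  assumes "blaschke_sequence a"
  shows "(\<lambda>w. \<Prod>n<N. blaschke_factor (a n) w) holomorphic_on ball 0 1"
  using assms by (intro holomorphic_on_prod holomorphic_blaschke_factor)
                 (auto simp: blaschke_sequence_def)

lemma holomorphic_blaschke_product:
  assumes "blaschke_sequence a"
  shows "blaschke_product a holomorphic_on ball 0 1"
proof (rule holomorphic_uniform_sequence)
  show "(\<lambda>w. \<Prod>n<N. blaschke_factor (a n) w) holomorphic_on ball 0 1" for N
    using assms by (rule partial_blaschke_product_holomorphic)
next
  fix z :: complex assume z: "z \<in> ball 0 1"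
  define d where "d = (1 - cmod z) / 2"
  have sub: "cball z d \<subseteq> cball 0 ((1 + cmod z) / 2)"
  proof
    fix w assume "w \<in> cball z d"
    then have "cmod (w - z) \<le> d"
      by (simp add: dist_norm norm_minus_commute)
    then show "w \<in> cball 0 ((1 + cmod z) / 2)"
      using norm_triangle_sub[of w z] by (simp add: d_def field_simps)
  qed
  show "\<exists>d>0. cball z d \<subseteq> ball 0 1 \<and> uniform_limit (cball z d)
          (\<lambda>N w. \<Prod>n<N. blaschke_factor (a n) w) (blaschke_product a) sequentially"
  proof (intro exI[of _ d] conjI)
    show "d > 0" using z by (simp add: d_def)
    have "cball 0 ((1 + cmod z) / 2) \<subseteq> (ball 0 1 :: complex set)"
      using z by auto
    with sub show "cball z d \<subseteq> ball 0 1" by blast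
    show "uniform_limit (cball z d) (\<lambda>N w. \<Prod>n<N. blaschke_factor (a n) w)
            (blaschke_product a) sequentially"
      using z by (intro uniform_limit_on_subset[OF uniform_limit_blaschke_product[OF assms] sub])
                 simp
  qed
qed auto

text \<open>The finite product rule bounds the derivatives of the partial products independently of their
  length, and locally uniform convergence carries the bound over to the limit.\<close>

lemma norm_deriv_blaschke_product_le:
  assumes a: "blaschke_sequence a" and z: "cmod z < 1"
    and M: "\<And>n. 1 / (cmod (1 - cnj (a n) * z))\<^sup>2 \<le> M"
  shows "cmod (deriv (blaschke_product a) z) \<le> (\<Sum>n. 2 * (1 - cmod (a n))) * M"
proof -
  have a1: "cmod (a n) < 1" for n
    using a by (auto simp: blaschke_sequence_def)
  have sa: "summable (\<lambda>n. 2 * (1 - cmod (a n)))"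
    using a by (intro summable_mult) (simp add: blaschke_sequence_def)
  have M0: "M \<ge> 0"
    using order_trans[OF _ M[of 0], of 0] by simp
  define r where "r = (1 + cmod z) / 2"
  have r: "r < 1" "cmod z < r"
    using z by (auto simp: r_def)
  have "(\<lambda>N. deriv (\<lambda>w. \<Prod>n<N. blaschke_factor (a n) w) z) \<longlonglongrightarrow> deriv (blaschke_product a) z"
  proof (rule deriv_complex_uniform_limit)
    show "uniform_limit (ball 0 r) (\<lambda>N w. \<Prod>n<N. blaschke_factor (a n) w)
            (blaschke_product a) sequentially"
      by (rule uniform_limit_on_subset[OF uniform_limit_blaschke_product[OF a r(1)]]) auto
    show "\<forall>\<^sub>F N in sequentially. (\<lambda>w. \<Prod>n<N. blaschke_factor (a n) w) holomorphic_on ball 0 r"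
      using r by (intro always_eventually allI
          holomorphic_on_subset[OF partial_blaschke_product_holomorphic[OF a]]) auto
  qed (use r in auto)
  moreover have "cmod (deriv (\<lambda>w. \<Prod>n<N. blaschke_factor (a n) w) z)
                   \<le> (\<Sum>n. 2 * (1 - cmod (a n))) * M" for N
  proof -
    have "cmod (deriv (\<lambda>w. \<Prod>n<N. blaschke_factor (a n) w) z)
        \<le> (\<Sum>n<N. cmod (deriv (blaschke_factor (a n)) z))"
    proof (rule norm_deriv_prod_le_sum)
      show "blaschke_factor (a n) field_differentiable at z" for n
        by (rule field_differentiable_blaschke_factor[OF a1 z])
      show "cmod (blaschke_factor (a n) z) \<le> 1" for n
        by (rule norm_blaschke_factor_le_1[OF a1 z])
    qed
    also have "\<dots> \<le> (\<Sum>n<N. 2 * (1 - cmod (a n)) * M)"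
    proof (rule sum_mono)
      fix n
      have "cmod (deriv (blaschke_factor (a n)) z)
          \<le> 2 * (1 - cmod (a n)) * (1 / (cmod (1 - cnj (a n) * z))\<^sup>2)"
        using norm_deriv_blaschke_factor_le[OF a1 z, of n] by simp
      also have "\<dots> \<le> 2 * (1 - cmod (a n)) * M"
        using a1[of n] by (intro mult_left_mono M) auto
      finally show "cmod (deriv (blaschke_factor (a n)) z) \<le> 2 * (1 - cmod (a n)) * M" .
    qed
    also have "\<dots> = (\<Sum>n<N. 2 * (1 - cmod (a n))) * M"
      by (simp add: sum_distrib_right)
    also have "\<dots> \<le> (\<Sum>n. 2 * (1 - cmod (a n))) * M"
      using a1 by (intro mult_right_mono sum_le_suminf sa M0) (auto simp: less_imp_le)
    finally show ?thesis .
  qed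
  ultimately show ?thesis
    by (intro Lim_bounded[OF tendsto_norm]) auto
qed

section \<open>Zeros in a Stolz region\<close>

lemma exp_weight_mono:
  assumes "0 < x" "x \<le> y" "\<rho> \<ge> 0"
  shows "exp_weight \<rho> x \<le> exp_weight \<rho> y"
  using assms by (auto simp: exp_weight_def intro!: powr_mono2')

text \<open>With \<open>t = - \<rho> * ln d\<close> this is \<open>t \<le> exp t\<close>, multiplied by \<open>2 / \<rho>\<close> and exponentiated.\<close>

lemma inverse_square_le_exp:
  fixes d \<rho> :: real
  assumes "d > 0" "\<rho> > 0"
  shows "1 / d\<^sup>2 \<le> exp (2 / \<rho> / d powr \<rho>)"
proof -
  have "2 / \<rho> * (- (\<rho> * ln d)) = - (2 * ln d)"
    using assms by simp
  then have "1 / d\<^sup>2 = exp (2 / \<rho> * (- (\<rho> * ln d)))"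
    using assms by (simp only: exp_minus exp_double exp_ln inverse_eq_divide)
  also have "\<dots> \<le> exp (2 / \<rho> * exp (- (\<rho> * ln d)))"
    using assms exp_ge_add_one_self[of "- (\<rho> * ln d)"]
    by (subst exp_le_cancel_iff, intro mult_left_mono) (linarith, simp)
  also have "exp (- (\<rho> * ln d)) = 1 / d powr \<rho>"
    using assms by (simp add: powr_def exp_minus divide_inverse)
  finally show ?thesis by simp
qed

text \<open>The crux: either \<open>a\<close> is at least half as far from \<open>E\<close> as \<open>z\<close>, and the Stolz condition bounds
  \<open>1 - \<bar>a\<bar>\<close> from below, or \<open>a\<close> is far from \<open>z\<close> itself. The right-hand side adds up the bounds for
  the two cases: \<open>K\<^sup>2\<close> and \<open>2 * 2 powr \<rho>\<close> come from the first, \<open>4\<close> and \<open>2 / \<rho>\<close> from the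
  second.\<close>

lemma inverse_square_one_minus_cnj_mult_le:
  fixes a z :: complex
  assumes \<rho>: "\<rho> > 0" and K: "K > 0"
    and a: "a \<in> stolz_region (exp_weight \<rho>) E K"
    and z: "cmod z < 1" and d: "infdist z E > 0"
  shows "1 / (cmod (1 - cnj a * z))\<^sup>2
           \<le> (K\<^sup>2 + 4) * exp ((2 * 2 powr \<rho> + 2 / \<rho>) / infdist z E powr \<rho>)"
proof -
  define d where "d = infdist z E"
  have d0: "d > 0" using d by (simp add: d_def)
  define x where "x = cmod (1 - cnj a * z)"
  have a1: "cmod a < 1" and wa: "exp_weight \<rho> (infdist a E) \<le> K * (1 - cmod a)"
    using a by (auto simp: stolz_region_def)
  have x0: "x > 0"
    using one_minus_cnj_mult_nonzero[OF a1 z] by (simp add: x_def)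
  define S where "S = (2 * 2 powr \<rho> + 2 / \<rho>) / d powr \<rho>"
  show ?thesis
  proof (cases "infdist a E \<ge> d / 2")
    case True
    have "(d / 2) powr (- \<rho>) = 2 powr \<rho> / d powr \<rho>"
      using d0 by (simp add: powr_divide powr_minus_divide)
    then have "exp (- (2 powr \<rho> / d powr \<rho>)) = exp_weight \<rho> (d / 2)"
      using d0 by (simp add: exp_weight_def)
    also have "\<dots> \<le> exp_weight \<rho> (infdist a E)"
      using True d0 \<rho> by (intro exp_weight_mono) auto
    also have "\<dots> \<le> K * (1 - cmod a)" by (rule wa)
    also have "\<dots> \<le> K * x"
      using K one_minus_cnj_mult_ge(1)[of a z] a1 z by (auto simp: x_def)
    finally have "1 / x \<le> K * exp (2 powr \<rho> / d powr \<rho>)"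
      using x0 by (simp add: exp_minus field_simps)
    then have "(1 / x)\<^sup>2 \<le> (K * exp (2 powr \<rho> / d powr \<rho>))\<^sup>2"
      using x0 by (intro power_mono) auto
    also have "\<dots> = K\<^sup>2 * exp (2 * 2 powr \<rho> / d powr \<rho>)"
      by (simp add: power_mult_distrib exp_double[symmetric])
    also have "\<dots> \<le> (K\<^sup>2 + 4) * exp S"
      using \<rho> d0 by (intro mult_mono) (auto simp: S_def divide_right_mono)
    finally show ?thesis by (simp add: power_divide x_def S_def d_def)
  next
    case False
    have "d \<le> infdist a E + dist z a"
      unfolding d_def by (rule infdist_triangle)
    with False have "d / 2 \<le> cmod (a - z)"
      by (simp add: dist_norm norm_minus_commute)
    also have "\<dots> \<le> x"
      using norm_diff_le_one_minus_cnj_mult[of a z] a1 z by (simp add: x_def)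
    finally have "1 / x\<^sup>2 \<le> 1 / (d / 2)\<^sup>2"
      using d0 by (intro divide_left_mono power_mono mult_pos_pos zero_less_power x0) auto
    also have "\<dots> = 4 * (1 / d\<^sup>2)"
      by (simp add: power_divide)
    also have "\<dots> \<le> 4 * exp (2 / \<rho> / d powr \<rho>)"
      using inverse_square_le_exp[OF d0 \<rho>] by simp
    also have "\<dots> \<le> (K\<^sup>2 + 4) * exp S"
    proof -
      have "2 / \<rho> / d powr \<rho> \<le> S"
        unfolding S_def by (intro divide_right_mono) auto
      then show ?thesis by (intro mult_mono) auto
    qed
    finally show ?thesis by (simp add: x_def S_def d_def)
  qed
qed

theorem mainTheorem5:
  fixes E :: "complex set" and \<rho> K :: real and a :: "nat \<Rightarrow> complex"
  assumes "closed E" and "E \<subseteq> sphere 0 1" and "E \<noteq> {}"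
    and "\<rho> > 0" and "K > 0"
    and "blaschke_sequence a"
    and "range a \<subseteq> stolz_region (exp_weight \<rho>) E K"
  shows "deriv (blaschke_product a) \<in> growth_space E \<rho>"
proof -
  define L where "L = (\<Sum>n. 2 * (1 - cmod (a n)))"
  define C2 where "C2 = 2 * 2 powr \<rho> + 2 / \<rho>"
  have a1: "cmod (a n) < 1" for n
    using assms(6) by (auto simp: blaschke_sequence_def)
  have "summable (\<lambda>n. 2 * (1 - cmod (a n)))"
    using assms(6) by (intro summable_mult) (simp add: blaschke_sequence_def)
  \<comment> \<open>Every term is positive because each zero lies strictly inside the disk, so the first growth
    constant is positive, as the definition of the growth space demands.\<close>
  then have L: "L > 0"
    unfolding L_def using a1 by (intro suminf_pos) auto
  have "cmod (deriv (blaschke_product a) z) \<le> (L * (K\<^sup>2 + 4)) * exp (C2 / infdist z E powr \<rho>)"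
    if z: "z \<in> ball 0 1" for z
  proof -
    have "z \<notin> E"
      using z assms(2) by auto
    then have "infdist z E > 0"
      using assms(1,3) infdist_pos_not_in_closed by blast
    then have "1 / (cmod (1 - cnj (a n) * z))\<^sup>2 \<le> (K\<^sup>2 + 4) * exp (C2 / infdist z E powr \<rho>)" for n
      unfolding C2_def using z assms(4,5,7)
      by (intro inverse_square_one_minus_cnj_mult_le) auto
    then show ?thesis
      using norm_deriv_blaschke_product_le[OF assms(6), of z] z by (simp add: L_def mult.assoc)
  qed
  moreover have "L * (K\<^sup>2 + 4) > 0"
    using L by (simp add: add_nonneg_pos)
  moreover have "C2 > 0"
    using assms(4) by (simp add: C2_def add_pos_pos)
  moreover have "deriv (blaschke_product a) holomorphic_on ball 0 1"
    using assms(6) by (intro holomorphic_deriv holomorphic_blaschke_product) auto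
  ultimately show ?thesis
    unfolding growth_space_def by blast
qed

end
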